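(* Let $w=(w(n))_{n\in\mathbb{N}}$ be a nonnegative weight sequence such that $W(\infty)=\infty$. An element $x\in S_{\gamma_{1,w}}$ is an extreme point of $B_{\gamma_{1,w}}$ if and only if there exists $n_0\in\mathbb{N}$ such that $$x^*=\frac{1}{\phi_{\gamma_{1,w}}(n_0)}\chi_{\{i\in\mathbb{N}:\,i\le n_0\}}$$ and, in case $n_0>1$, $W(n_0-1)>0$.
   Context: $\mathbb{N}$ is the set of positive integers and $\ell^0$ is the set of all real sequences. For $x\in\ell^0$ put $d_x(\lambda)=\operatorname{card}\{k\in\mathbb{N}:|x(k)|>\lambda\}$ for $\lambda\ge 0$, $x^*(n)=\inf\{\lambda\ge 0: d_x(\lambda)\le n-1\}$ (decreasing rearrangement) and $x^{**}(n)=\frac1n\sum_{i=1}^n x^*(i)$ for $n\in\mathbb{N}$. A nonnegative weight sequence is a sequence $w=(w(n))_{n\in\mathbb{N}}$ of nonnegative reals, with $w(n)>0$ for at least one $n$, such that $W_1(n)=n\sum_{i=n+1}^\infty \frac{w(i)}{i}<\infty$ for every $n\in\mathbb{N}$. Put $W(n)=\sum_{i=1}^n w(i)$ and $W(\infty)=\sum_{i=1}^\infty w(i)\in(0,\infty]$. The sequence Lorentz space $\gamma_{1,w}$ is the Banach space of all $x\in\ell^0$ with $\|x\|_{\gamma_{1,w}}=\sum_{n=1}^\infty x^{**}(n) w(n)<\infty$. Its fundamental sequence is $\phi_{\gamma_{1,w}}(n)=\|\chi_{\{i\in\mathbb{N}:i\le n\}}\|_{\gamma_{1,w}}=W(n)+W_1(n)$,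 $n\in\mathbb{N}$. $S_X$ and $B_X$ denote the unit sphere and the closed unit ball of a Banach space $X$; $x\in S_X$ is an extreme point of $B_X$ if for any $y,z\in S_X$ with $x=(y+z)/2$ one has $x=y=z$. *)

theory Defs
  imports "HOL-Analysis.Analysis"
begin

text \<open>
  Sequences indexed by the positive integers are functions \<^typ>\<open>nat \<Rightarrow> real\<close>. The index 0 is not
  part of the sequence: elements of the sequence space take the value 0 there, so that two of
  them are equal iff they agree at all positive indices, and every other definition
  ignores it. Quantities that may be infinite are of type \<^typ>\<open>ennreal\<close>, where
  the infimum of the empty set is \<^term>\<open>\<infinity> :: ennreal\<close> and \<^prop>\<open>(\<infinity> :: ennreal) * 0 = 0\<close>.
\<close>

definition ell0 :: "(nat \<Rightarrow> real) set" where
  "ell0 = {x. x 0 = 0}"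

text \<open>Counting measure instead of \<^const>\<open>card\<close>, so that an infinite set gets the value \<^term>\<open>\<infinity> :: ennreal\<close>.\<close>

definition distr_fun :: "(nat \<Rightarrow> real) \<Rightarrow> real \<Rightarrow> ennreal" where
  "distr_fun x t = emeasure (count_space {1..}) {k \<in> {1..}. \<bar>x k\<bar> > t}"

definition decr_rearr :: "(nat \<Rightarrow> real) \<Rightarrow> nat \<Rightarrow> ennreal" where
  "decr_rearr x n = Inf {ennreal t | t. 0 \<le> t \<and> distr_fun x t \<le> of_nat (n - 1)}"

definition max_rearr :: "(nat \<Rightarrow> real) \<Rightarrow> nat \<Rightarrow> ennreal" where
  "max_rearr x n = (\<Sum>i=1..n. decr_rearr x i) / of_nat n"

definition W :: "(nat \<Rightarrow> real) \<Rightarrow> nat \<Rightarrow> real" where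
  "W w n = (\<Sum>i=1..n. w i)"

definition W_inf :: "(nat \<Rightarrow> real) \<Rightarrow> ennreal" where
  "W_inf w = (\<Sum>i. ennreal (w (Suc i)))"

definition W1 :: "(nat \<Rightarrow> real) \<Rightarrow> nat \<Rightarrow> ennreal" where
  "W1 w n = of_nat n * (\<Sum>i. ennreal (w (n + 1 + i) / real (n + 1 + i)))"

definition weight_seq :: "(nat \<Rightarrow> real) \<Rightarrow> bool" where
  "weight_seq w \<longleftrightarrow> (\<forall>n\<ge>1. 0 \<le> w n) \<and> (\<exists>n\<ge>1. 0 < w n) \<and> (\<forall>n\<ge>1. W1 w n < \<infinity>)"

definition lorentz_norm :: "(nat \<Rightarrow> real) \<Rightarrow> (nat \<Rightarrow> real) \<Rightarrow> ennreal" where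
  "lorentz_norm w x = (\<Sum>n. max_rearr x (Suc n) * ennreal (w (Suc n)))"

definition lorentz_space :: "(nat \<Rightarrow> real) \<Rightarrow> (nat \<Rightarrow> real) set" where
  "lorentz_space w = {x \<in> ell0. lorentz_norm w x < \<infinity>}"

definition lorentz_sphere :: "(nat \<Rightarrow> real) \<Rightarrow> (nat \<Rightarrow> real) set" where
  "lorentz_sphere w = {x \<in> lorentz_space w. lorentz_norm w x = 1}"

definition extreme_point_lorentz_ball :: "(nat \<Rightarrow> real) \<Rightarrow> (nat \<Rightarrow> real) \<Rightarrow> bool" where
  "extreme_point_lorentz_ball w x \<longleftrightarrow> x \<in> lorentz_sphere w \<and>
     (\<forall>y \<in> lorentz_sphere w. \<forall>z \<in> lorentz_sphere w.
        x = (\<lambda>k. (y k + z k) / 2) \<longrightarrow> x = y \<and> y = z)"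

definition fund_seq :: "(nat \<Rightarrow> real) \<Rightarrow> nat \<Rightarrow> ennreal" where
  "fund_seq w n = lorentz_norm w (indicator {1..n})"

lemma decr_rearr_indicator:
  assumes "1 \<le> m"
  shows "decr_rearr (indicator {1..n}) m = indicator {1..n} m"
proof -
  have d: "distr_fun (indicator {1..n}) l = (if l < 1 then of_nat n else 0)" if "0 \<le> l" for l
  proof -
    have "{k \<in> {1..}. \<bar>indicator {1..n} k\<bar> > l} = (if l < 1 then {1..n} else {})"
      using that by (auto simp: indicator_def split: if_splits)
    then show ?thesis by (auto simp: distr_fun_def)
  qed
  have eq: "{ennreal l | l. 0 \<le> l \<and> distr_fun (indicator {1..n}) l \<le> of_nat (m - 1)} =
        (if m \<le> n then {ennreal l | l. 1 \<le> l} else {ennreal l | l. 0 \<le> l})"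
  proof -
    have "distr_fun (indicator {1..n}) l \<le> of_nat (m - 1) \<longleftrightarrow> 1 \<le> l \<or> n < m" if "0 \<le> l" for l
    proof -
      have "(of_nat n :: ennreal) \<le> of_nat (m - 1) \<longleftrightarrow> n < m"
        unfolding of_nat_le_iff using assms by linarith
      then show ?thesis unfolding d[OF that] by (cases "l < 1") (auto simp: not_less)
    qed
    then have "0 \<le> l \<and> distr_fun (indicator {1..n}) l \<le> of_nat (m - 1) \<longleftrightarrow>
        (if m \<le> n then 1 \<le> l else 0 \<le> l)" for l
      by (cases "0 \<le> l") auto
    then show ?thesis by simp
  qed
  have "Inf {ennreal l | l. 1 \<le> l} = 1"
    by (intro Inf_eqI) (auto intro!: exI[of _ 1])
  moreover have "Inf {ennreal l | l. 0 \<le> l} = 0"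
    using Inf_lower[of "0 :: ennreal" "{ennreal l | l. 0 \<le> l}"] by (force intro: exI[of _ 0])
  ultimately show ?thesis
    using assms unfolding decr_rearr_def eq by auto
qed

lemma fund_seq_eq:
  assumes "weight_seq w" "1 \<le> n"
  shows "fund_seq w n = ennreal (W w n) + W1 w n"
proof -
  have nn: "0 \<le> w i" if "1 \<le> i" for i
    using assms that by (auto simp: weight_seq_def)
  have mx: "max_rearr (indicator {1..n}) m = of_nat (min m n) / of_nat m" if "1 \<le> m" for m
  proof -
    have "(\<Sum>i=1..m. decr_rearr (indicator {1..n}) i) = (\<Sum>i=1..m. indicator {1..n} i :: ennreal)"
      by (intro sum.cong refl decr_rearr_indicator) auto
    also have "\<dots> = of_nat (min m n)"
    proof -
      have "{Suc 0..m} \<inter> {i. i \<le> n} = {Suc 0..min m n}" by auto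
      then show ?thesis by (simp add: indicator_def sum.If_cases)
    qed
    finally show ?thesis unfolding max_rearr_def by simp
  qed
  let ?f = "\<lambda>k. max_rearr (indicator {1..n}) (Suc k) * ennreal (w (Suc k))"
  have "fund_seq w n = (\<Sum>k. ?f (k + n)) + (\<Sum>k<n. ?f k)"
    unfolding fund_seq_def lorentz_norm_def by (rule suminf_offset) auto
  also have "(\<Sum>k<n. ?f k) = (\<Sum>k<n. ennreal (w (Suc k)))"
    by (intro sum.cong refl, subst mx) (auto simp: min_def ennreal_divide_self of_nat_less_top simp del: of_nat_Suc)
  also have "\<dots> = ennreal (W w n)"
    using sum.atLeast1_atMost_eq[of w n] by (simp add: W_def nn sum_ennreal)
  also have "(\<Sum>k. ?f (k + n)) = (\<Sum>k. of_nat n * ennreal (w (n + 1 + k) / real (n + 1 + k)))"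
  proof (intro suminf_cong)
    fix k
    have "?f (k + n) = of_nat n / of_nat (n + 1 + k) * ennreal (w (n + 1 + k))"
      by (subst mx) (auto simp: min_def add_ac simp del: of_nat_Suc)
    also have "\<dots> = ennreal (real n / real (n + 1 + k)) * ennreal (w (n + 1 + k))"
      by (simp only: ennreal_of_nat_eq_real_of_nat) (subst divide_ennreal, auto)
    also have "\<dots> = ennreal (real n) * ennreal (w (n + 1 + k) / real (n + 1 + k))"
      using nn[of "n + 1 + k"] by (simp add: ennreal_mult[symmetric] del: of_nat_add of_nat_Suc)
    finally show "?f (k + n) = of_nat n * ennreal (w (n + 1 + k) / real (n + 1 + k))"
      by (simp add: ennreal_of_nat_eq_real_of_nat)
  qed
  also have "\<dots> = W1 w n"
    by (simp add: W1_def del: of_nat_add)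
  finally show ?thesis by (simp add: add.commute)
qed

end

theory Submission
  imports Defs
begin

text \<open>
  The sum \<open>T\<^sub>n(x) = x\<^sup>*(1) + \<dots> + x\<^sup>*(n)\<close> is the largest value of \<open>\<Sum>\<^bsub>k\<in>A\<^esub> \<bar>x(k)\<bar>\<close> over sets
  \<open>A\<close> of \<open>n\<close> indices (\<open>sum_le_top_sum\<close>, \<open>top_sum_eq\<close>), and the norm of \<open>x\<close> is
  \<open>\<Sum>\<^sub>n T\<^sub>n(x) w(n) / n\<close>. If \<open>W(\<infinity>) = \<infinity>\<close>, then every \<open>x\<close> of finite norm tends to 0
  (\<open>lorentz_space_tendsto_zero\<close>), so the maximum is attained, at a set of \<open>n\<close> largest entries. Two
  consequences carry the proof: \<open>T\<^sub>n\<close> is convex, and it is additive on sequences that share their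
  sets of largest entries.

  Necessity. Suppose that \<open>\<bar>x\<bar>\<close> takes two different nonzero values, and let \<open>b\<close> be the smaller one.
  Truncating \<open>x\<close> at height \<open>b\<close> splits it into \<open>x = u + v\<close>, with \<open>u\<close> the part below \<open>b\<close> and \<open>v\<close> the
  part above. Both \<open>\<bar>u\<bar>\<close> and \<open>\<bar>v\<bar>\<close> are monotone functions of \<open>\<bar>x\<bar>\<close>, so the norm is additive on
  nonnegative combinations of \<open>u\<close> and \<open>v\<close>, and \<open>x\<close> is an interior point of a segment in the sphere
  (\<open>extreme_point_abs_eq\<close>). Hence \<open>\<bar>x\<bar>\<close> is constant on its support, which is finite because \<open>x\<close> tends
  to 0; let \<open>n\<^sub>0\<close> be its size. If \<open>n\<^sub>0 > 1\<close> and \<open>W(n\<^sub>0 - 1) = 0\<close>, then the norm only sees \<open>T\<^sub>n\<close> with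
  \<open>n \<ge> n\<^sub>0\<close>, and moving mass from one support point to another in either direction leaves it unchanged
  (\<open>extreme_point_W_pos\<close>).

  Sufficiency. Let \<open>\<bar>x\<bar>\<close> equal \<open>c\<close> on a set \<open>A\<close> of size \<open>n\<^sub>0\<close> and 0 elsewhere, and let \<open>x\<close> be the
  midpoint of \<open>y\<close> and \<open>z\<close> in the sphere. By convexity \<open>2 T\<^sub>n(x) \<le> T\<^sub>n(y) + T\<^sub>n(z)\<close> for all \<open>n\<close>, and
  after weighting and summing both sides give 2; so equality holds whenever \<open>w(n) > 0\<close>
  (\<open>midpoint_sums_le\<close>). Such \<open>n\<close> exist above every bound, and for \<open>n > n\<^sub>0\<close> the equality yields
  \<open>\<bar>y\<bar> + \<bar>z\<bar> = 2 \<bar>x\<bar>\<close> everywhere. If \<open>n\<^sub>0 > 1\<close>, there is also such an \<open>n < n\<^sub>0\<close>; comparing two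
  subsets of \<open>A\<close> of size \<open>n\<close> that differ in a single element shows that \<open>\<bar>y\<bar>\<close> is constant on \<open>A\<close>. The
  norm then fixes this constant to be \<open>c\<close>, and \<open>y = z = x\<close> follows (\<open>flat_extreme_point\<close>).
\<close>

section \<open>Sums of largest entries\<close>

definition top_sum :: "(nat \<Rightarrow> real) \<Rightarrow> nat \<Rightarrow> ennreal" where
  "top_sum x n = (\<Sum>i=1..n. decr_rearr x i)"

definition top_set :: "(nat \<Rightarrow> real) \<Rightarrow> nat set \<Rightarrow> bool" where
  "top_set x A \<longleftrightarrow> finite A \<and> A \<subseteq> {1..} \<and> (\<forall>i\<in>A. \<forall>j\<in>{1..} - A. \<bar>x j\<bar> \<le> \<bar>x i\<bar>)"

lemma distr_fun_le_iff:
  "distr_fun x t \<le> of_nat n \<longleftrightarrow>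
     finite {k\<in>{1..}. t < \<bar>x k\<bar>} \<and> card {k\<in>{1..}. t < \<bar>x k\<bar>} \<le> n"
  unfolding distr_fun_def by (subst emeasure_count_space) (auto simp: top_unique)

lemma decr_rearr_le:
  assumes "0 \<le> t" "finite B" "{k\<in>{1..}. t < \<bar>x k\<bar>} \<subseteq> B" "card B \<le> n - 1"
  shows "decr_rearr x n \<le> ennreal t"
proof -
  have "distr_fun x t \<le> of_nat (n - 1)"
    unfolding distr_fun_le_iff
    using finite_subset[OF assms(3,2)] card_mono[OF assms(2,3)] assms(4) by simp
  then show ?thesis
    unfolding decr_rearr_def using assms(1) by (intro Inf_lower) auto
qed

lemma le_decr_rearr:
  assumes "B \<subseteq> {k\<in>{1..}. v \<le> \<bar>x k\<bar>}" "finite B" "n - 1 < card B"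
  shows "ennreal v \<le> decr_rearr x n"
  unfolding decr_rearr_def
proof (rule Inf_greatest)
  fix s assume "s \<in> {ennreal t | t. 0 \<le> t \<and> distr_fun x t \<le> of_nat (n - 1)}"
  then obtain t where s: "s = ennreal t" and d: "distr_fun x t \<le> of_nat (n - 1)" by blast
  show "ennreal v \<le> s"
    unfolding s
  proof (rule ccontr)
    assume "\<not> ennreal v \<le> ennreal t"
    then have "t < v" using ennreal_leI[of v t] by linarith
    then have sub: "B \<subseteq> {k\<in>{1..}. t < \<bar>x k\<bar>}" using assms(1) by auto
    have "finite {k\<in>{1..}. t < \<bar>x k\<bar>}" "card {k\<in>{1..}. t < \<bar>x k\<bar>} \<le> n - 1"
      using d unfolding distr_fun_le_iff by blast+
    then have "card B \<le> n - 1"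
      using card_mono[OF _ sub] by simp
    then show False using assms(3) by simp
  qed
qed

text \<open>
  Each step removes an entry of least modulus: all \<open>n\<close> entries are at least as large as it, so it is
  bounded by the \<open>n\<close>-th value of the rearrangement.
\<close>

lemma sum_le_top_sum:
  assumes "finite A" "A \<subseteq> {1..}" "card A = n"
  shows "ennreal (\<Sum>i\<in>A. \<bar>x i\<bar>) \<le> top_sum x n"
  using assms
proof (induction n arbitrary: A)
  case 0
  then show ?case by simp
next
  case (Suc n)
  have "A \<noteq> {}" using Suc.prems by auto
  then obtain m where m: "m \<in> A" "\<forall>i\<in>A. \<bar>x m\<bar> \<le> \<bar>x i\<bar>"
    using Suc.prems(1) ex_is_arg_min_if_finite[of A "\<lambda>i. \<bar>x i\<bar>"]
    by (auto simp: is_arg_min_linorder)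
  have "ennreal (\<Sum>i\<in>A. \<bar>x i\<bar>) = ennreal (\<Sum>i\<in>A - {m}. \<bar>x i\<bar>) + ennreal \<bar>x m\<bar>"
    using m(1) Suc.prems(1) by (simp add: sum.remove sum_nonneg add.commute flip: ennreal_plus)
  also have "\<dots> \<le> top_sum x n + decr_rearr x (Suc n)"
  proof (rule add_mono)
    show "ennreal (\<Sum>i\<in>A - {m}. \<bar>x i\<bar>) \<le> top_sum x n"
      using Suc m(1) by (intro Suc.IH) auto
    show "ennreal \<bar>x m\<bar> \<le> decr_rearr x (Suc n)"
      using Suc.prems m(2) by (intro le_decr_rearr[of A]) auto
  qed
  finally show ?case by (simp add: top_sum_def)
qed

text \<open>
  The reverse bound uses the same induction: a top set without a least entry is again a top set, and
  only its remaining elements can exceed the removed entry.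
\<close>

lemma top_sum_eq:
  assumes "top_set x A" "card A = n"
  shows "top_sum x n = ennreal (\<Sum>i\<in>A. \<bar>x i\<bar>)"
proof (rule antisym)
  show "top_sum x n \<le> ennreal (\<Sum>i\<in>A. \<bar>x i\<bar>)"
    using assms
  proof (induction n arbitrary: A)
    case 0
    then show ?case by (simp add: top_sum_def)
  next
    case (Suc n)
    have fin: "finite A" and sub: "A \<subseteq> {1..}" using Suc.prems by (auto simp: top_set_def)
    have "A \<noteq> {}" using Suc.prems by auto
    then obtain m where m: "m \<in> A" "\<forall>i\<in>A. \<bar>x m\<bar> \<le> \<bar>x i\<bar>"
      using fin ex_is_arg_min_if_finite[of A "\<lambda>i. \<bar>x i\<bar>"]
      by (auto simp: is_arg_min_linorder)
    have "top_sum x (Suc n) = top_sum x n + decr_rearr x (Suc n)"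
      by (simp add: top_sum_def)
    also have "\<dots> \<le> ennreal (\<Sum>i\<in>A - {m}. \<bar>x i\<bar>) + ennreal \<bar>x m\<bar>"
    proof (rule add_mono)
      have "top_set x (A - {m})" using Suc.prems m unfolding top_set_def by auto
      then show "top_sum x n \<le> ennreal (\<Sum>i\<in>A - {m}. \<bar>x i\<bar>)"
        using Suc.prems m(1) fin by (intro Suc.IH) auto
      have "{k\<in>{1..}. \<bar>x m\<bar> < \<bar>x k\<bar>} \<subseteq> A - {m}"
        using Suc.prems m unfolding top_set_def by force
      then show "decr_rearr x (Suc n) \<le> ennreal \<bar>x m\<bar>"
        using Suc.prems m(1) fin by (intro decr_rearr_le[of _ "A - {m}"]) auto
    qed
    also have "\<dots> = ennreal (\<Sum>i\<in>A. \<bar>x i\<bar>)"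
      using m(1) fin by (simp add: sum.remove sum_nonneg add.commute flip: ennreal_plus)
    finally show ?case .
  qed
  show "ennreal (\<Sum>i\<in>A. \<bar>x i\<bar>) \<le> top_sum x n"
    using assms by (intro sum_le_top_sum) (auto simp: top_set_def)
qed

lemma finite_level_set:
  fixes x :: "nat \<Rightarrow> real"
  assumes "x \<longlonglongrightarrow> 0" "0 < t"
  shows "finite {k. t \<le> \<bar>x k\<bar>}"
proof -
  have "\<forall>\<^sub>F k in cofinite. \<bar>x k\<bar> < t"
    using tendstoD[OF assms] by (simp add: dist_real_def cofinite_eq_sequentially)
  then show ?thesis by (simp add: eventually_cofinite not_less)
qed

text \<open>
  A top set grows by an index of largest modulus outside it. This maximum exists because only
  finitely many entries are as large as a given nonzero one.
\<close>

lemma ex_top_set: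
  assumes "x \<longlonglongrightarrow> 0"
  shows "\<exists>A. top_set x A \<and> card A = n"
proof (induction n)
  case 0
  then show ?case by (intro exI[of _ "{}"]) (simp add: top_set_def)
next
  case (Suc n)
  then obtain A where A: "top_set x A" "card A = n" by auto
  then have fin: "finite A" by (simp add: top_set_def)
  have "\<exists>k\<in>{1..} - A. \<forall>j\<in>{1..} - A. \<bar>x j\<bar> \<le> \<bar>x k\<bar>"
  proof (cases "\<exists>k\<in>{1..} - A. x k \<noteq> 0")
    case True
    then obtain k0 where k0: "k0 \<in> {1..} - A" "x k0 \<noteq> 0" by auto
    define L where "L = {k. \<bar>x k0\<bar> \<le> \<bar>x k\<bar>} \<inter> ({1..} - A)"
    have "finite L" using finite_level_set[OF assms, of "\<bar>x k0\<bar>"] k0 by (simp add: L_def)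
    moreover have "k0 \<in> L" using k0 by (simp add: L_def)
    ultimately have "\<exists>k\<in>L. \<forall>j\<in>L. \<bar>x j\<bar> \<le> \<bar>x k\<bar>"
      using ex_is_arg_min_if_finite[of L "\<lambda>i. - \<bar>x i\<bar>"] by (auto simp: is_arg_min_linorder)
    then show ?thesis using \<open>k0 \<in> L\<close> unfolding L_def by fastforce
  next
    case False
    have "infinite ({1..} - A)" using fin infinite_Ici by (metis Diff_infinite_finite)
    then obtain k where "k \<in> {1..} - A" by (metis ex_in_conv finite.emptyI)
    then show ?thesis using False by fastforce
  qed
  then obtain k where k: "k \<in> {1..} - A" "\<forall>j\<in>{1..} - A. \<bar>x j\<bar> \<le> \<bar>x k\<bar>" by auto
  then have "top_set x (insert k A)" using A(1) unfolding top_set_def by auto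
  moreover have "card (insert k A) = Suc n" using k(1) A fin by simp
  ultimately show ?case by blast
qed

text \<open>
  Sequences whose moduli are monotone functions of \<open>\<bar>x\<bar>\<close> inherit the top sets of \<open>x\<close>. This is
  the source of the additivity of the norm in \<open>lorentz_norm_comonotone\<close>.
\<close>

lemma top_set_mono_image:
  assumes "top_set x A" "mono f" "\<And>k. \<bar>u k\<bar> = f \<bar>x k\<bar>"
  shows "top_set u A"
  unfolding top_set_def assms(3)
  using assms(1,2) by (auto simp: top_set_def intro!: monoD[OF assms(2)])

lemma ex_superset_card:
  fixes A :: "nat set"
  assumes "finite A" "A \<subseteq> {1..}" "card A \<le> n"
  shows "\<exists>B. finite B \<and> A \<subseteq> B \<and> B \<subseteq> {1..} \<and> card B = n"
proof -
  have "n \<le> card (A \<union> {1..n})"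
    using card_mono[of "A \<union> {1..n}" "{1..n}"] assms by simp
  then obtain B where "A \<subseteq> B" "B \<subseteq> A \<union> {1..n}" "card B = n"
    using exists_subset_between[of A n "A \<union> {1..n}"] assms by auto
  moreover from this have "finite B" "B \<subseteq> {1..}"
    using assms finite_subset[of B "A \<union> {1..n}"] by auto
  ultimately show ?thesis by blast
qed

lemma top_sum_supported:
  assumes "finite A" "A \<subseteq> {1..}" "card A \<le> n" "\<And>k. k \<notin> A \<Longrightarrow> x k = 0"
  shows "top_sum x n = ennreal (\<Sum>i\<in>A. \<bar>x i\<bar>)"
proof -
  obtain B where B: "finite B" "A \<subseteq> B" "B \<subseteq> {1..}" "card B = n"
    using ex_superset_card[OF assms(1-3)] by auto
  have "top_set x B" using B assms(4) unfolding top_set_def by force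
  then have "top_sum x n = ennreal (\<Sum>i\<in>B. \<bar>x i\<bar>)" using B(4) by (rule top_sum_eq)
  also have "(\<Sum>i\<in>B. \<bar>x i\<bar>) = (\<Sum>i\<in>A. \<bar>x i\<bar>)"
    using B assms(4) by (intro sum.mono_neutral_right) auto
  finally show ?thesis .
qed

section \<open>The norm\<close>

text \<open>
  In this form the norm is linear in the sums \<open>T\<^sub>n\<close>, and these are accessible through finite index
  sets rather than through the infima that define the rearrangement.
\<close>

lemma lorentz_norm_top_sum:
  assumes "weight_seq w"
  shows "lorentz_norm w x = (\<Sum>n. top_sum x (Suc n) * ennreal (w (Suc n) / real (Suc n)))"
  unfolding lorentz_norm_def
proof (intro suminf_cong)
  fix n
  have "ennreal (w (Suc n)) / of_nat (Suc n) = ennreal (w (Suc n) / real (Suc n))"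
    using assms unfolding weight_seq_def
    by (subst divide_ennreal[symmetric]) (auto simp: ennreal_of_nat_eq_real_of_nat simp del: of_nat_Suc)
  then show "max_rearr x (Suc n) * ennreal (w (Suc n))
      = top_sum x (Suc n) * ennreal (w (Suc n) / real (Suc n))"
    by (simp only: max_rearr_def top_sum_def ennreal_divide_times)
qed

lemma lorentz_norm_pos:
  assumes w: "weight_seq w" and k: "1 \<le> k" "x k \<noteq> 0"
  shows "0 < lorentz_norm w x"
proof -
  obtain m where m: "1 \<le> m" "0 < w m" using w by (auto simp: weight_seq_def)
  then obtain n where n: "m = Suc n" by (cases m) auto
  obtain B where B: "finite B" "{k} \<subseteq> B" "B \<subseteq> {1..}" "card B = m"
    using ex_superset_card[of "{k}" m] k m by auto
  have "0 < (\<Sum>i\<in>B. \<bar>x i\<bar>)" using B k by (intro sum_pos2[of B k]) auto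
  then have "0 < top_sum x (Suc n)"
    using sum_le_top_sum[of B m x] B n by (auto intro: less_le_trans[of _ "ennreal (\<Sum>i\<in>B. \<bar>x i\<bar>)"])
  then have "0 < top_sum x (Suc n) * ennreal (w (Suc n) / real (Suc n))"
    using m n by (simp add: ennreal_zero_less_mult_iff)
  then show ?thesis
    unfolding lorentz_norm_top_sum[OF w] using suminf_eq_zero_iff[of
        "\<lambda>n. top_sum x (Suc n) * ennreal (w (Suc n) / real (Suc n))"]
    by (auto simp: zero_less_iff_neq_zero)
qed

text \<open>
  If infinitely many entries have modulus at least \<open>t\<close>, then \<open>x\<^sup>*\<close> and hence \<open>x\<^sup>*\<^sup>*\<close> never falls below
  \<open>t\<close>, and the norm is at least \<open>t W(\<infinity>)\<close>.
\<close>

lemma lorentz_space_tendsto_zero: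
  assumes w: "weight_seq w" and inf: "W_inf w = \<infinity>" and x: "x \<in> lorentz_space w"
  shows "x \<longlonglongrightarrow> 0"
proof (rule ccontr)
  assume "\<not> x \<longlonglongrightarrow> 0"
  then obtain t where t: "0 < t" "infinite {k. t \<le> \<bar>x k\<bar>}"
    by (force simp: tendsto_iff dist_real_def eventually_cofinite not_less
        simp flip: cofinite_eq_sequentially)
  then have infk: "infinite {k\<in>{1..}. t \<le> \<bar>x k\<bar>}"
  proof -
    have "{k. t \<le> \<bar>x k\<bar>} \<subseteq> insert 0 {k\<in>{1..}. t \<le> \<bar>x k\<bar>}" by auto
    then show ?thesis using t(2) finite_subset by auto
  qed
  have d: "ennreal t \<le> decr_rearr x n" for n
  proof -
    obtain C where "finite C" "card C = Suc n" "C \<subseteq> {k\<in>{1..}. t \<le> \<bar>x k\<bar>}"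
      using infinite_arbitrarily_large[OF infk, of "Suc n"] by blast
    then show ?thesis by (intro le_decr_rearr[of C]) auto
  qed
  have m: "ennreal t \<le> max_rearr x (Suc n)" for n
  proof -
    have "of_nat (Suc n) * ennreal t \<le> (\<Sum>i=1..Suc n. decr_rearr x i)"
      using sum_mono[of "{1..Suc n}" "\<lambda>_. ennreal t" "decr_rearr x"] d by simp
    then have "of_nat (Suc n) * ennreal t / of_nat (Suc n) \<le> max_rearr x (Suc n)"
      unfolding max_rearr_def by (rule divide_right_mono_ennreal)
    moreover have "of_nat (Suc n) * ennreal t / of_nat (Suc n) = ennreal t"
      using t by (simp add: ennreal_of_nat_eq_real_of_nat divide_ennreal del: of_nat_Suc
          flip: ennreal_mult)
    ultimately show ?thesis by simp
  qed
  have "ennreal t * W_inf w \<le> lorentz_norm w x"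
    unfolding W_inf_def lorentz_norm_def ennreal_suminf_cmult[symmetric]
    by (intro suminf_le mult_right_mono m) auto
  then show False
    using inf x t by (simp add: lorentz_space_def ennreal_mult_top top_unique)
qed

text \<open>
  For each \<open>n\<close> a single top set of \<open>x\<close> computes \<open>T\<^sub>n\<close> for \<open>u\<close>, \<open>v\<close> and \<open>y\<close> at once, and on that
  set the sum is linear.
\<close>

lemma lorentz_norm_comonotone:
  fixes x u v y :: "nat \<Rightarrow> real"
  assumes w: "weight_seq w" and x: "x \<longlonglongrightarrow> 0"
    and f: "mono f" "\<And>k. \<bar>u k\<bar> = f \<bar>x k\<bar>"
    and g: "mono g" "\<And>k. \<bar>v k\<bar> = g \<bar>x k\<bar>"
    and ab: "0 \<le> a" "0 \<le> b" and y: "\<And>k. \<bar>y k\<bar> = a * \<bar>u k\<bar> + b * \<bar>v k\<bar>"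
  shows "lorentz_norm w y = ennreal a * lorentz_norm w u + ennreal b * lorentz_norm w v"
proof -
  have T: "top_sum y n = ennreal a * top_sum u n + ennreal b * top_sum v n" for n
  proof -
    obtain A where A: "top_set x A" "card A = n" using ex_top_set[OF x] by auto
    have "mono (\<lambda>t. a * f t + b * g t)"
      using ab f(1) g(1) by (auto intro!: monoI add_mono mult_left_mono dest: monoD)
    then have "top_set y A" by (rule top_set_mono_image[OF A(1)]) (simp add: y f g)
    moreover have "top_set u A" "top_set v A"
      using top_set_mono_image[OF A(1)] f g by blast+
    ultimately show ?thesis
      using A(2) ab by (simp add: top_sum_eq y sum.distrib sum_nonneg flip: sum_distrib_left ennreal_mult ennreal_plus)
  qed
  show ?thesis
    unfolding lorentz_norm_top_sum[OF w] T ennreal_suminf_cmult[symmetric]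
    by (subst suminf_add) (simp_all add: distrib_right mult.assoc)
qed

lemma decr_rearr_flat:
  assumes "finite A" "A \<subseteq> {1..}" "\<And>k. k \<in> A \<Longrightarrow> \<bar>x k\<bar> = c" "\<And>k. k \<notin> A \<Longrightarrow> x k = 0"
    and "0 \<le> c" "1 \<le> n"
  shows "decr_rearr x n = ennreal c * indicator {1..card A} n"
proof (cases "n \<le> card A")
  case True
  have "decr_rearr x n \<le> ennreal c"
  proof (rule decr_rearr_le[of c "{}"])
    have "\<bar>x k\<bar> \<le> c" for k using assms(3)[of k] assms(4)[of k] assms(5) by (cases "k \<in> A") auto
    then show "{k \<in> {1..}. c < \<bar>x k\<bar>} \<subseteq> {}" by (auto simp: not_less[symmetric])
  qed (use assms in auto)
  moreover have "ennreal c \<le> decr_rearr x n"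
    using assms True by (intro le_decr_rearr[of A]) auto
  ultimately show ?thesis using True assms by simp
next
  case False
  have "decr_rearr x n \<le> ennreal 0"
    using assms False by (intro decr_rearr_le[of 0 A]) auto
  then show ?thesis using False by simp
qed

lemma lorentz_norm_flat:
  assumes "finite A" "A \<subseteq> {1..}" "\<And>k. k \<in> A \<Longrightarrow> \<bar>x k\<bar> = c" "\<And>k. k \<notin> A \<Longrightarrow> x k = 0" "0 \<le> c"
  shows "lorentz_norm w x = ennreal c * fund_seq w (card A)"
proof -
  have "max_rearr x (Suc n) = ennreal c * max_rearr (indicator {1..card A}) (Suc n)" for n
  proof -
    have "(\<Sum>i=1..Suc n. decr_rearr x i)
        = (\<Sum>i=1..Suc n. ennreal c * decr_rearr (indicator {1..card A}) i)"
    proof (rule sum.cong[OF refl])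
      fix i assume "i \<in> {1..Suc n}"
      then have "1 \<le> i" by simp
      then show "decr_rearr x i = ennreal c * decr_rearr (indicator {1..card A}) i"
        using decr_rearr_flat[OF assms] decr_rearr_indicator by simp
    qed
    then show ?thesis
      by (simp add: max_rearr_def ennreal_times_divide flip: sum_distrib_left del: sum.cl_ivl_Suc)
  qed
  then show ?thesis
    by (simp add: fund_seq_def lorentz_norm_def mult.assoc)
qed

lemma fund_seq_pos:
  assumes "weight_seq w" "1 \<le> n"
  shows "0 < fund_seq w n"
  unfolding fund_seq_def using lorentz_norm_pos[OF assms(1), of 1 "indicator {1..n}"] assms(2)
  by simp

lemma fund_seq_finite:
  assumes "weight_seq w" "1 \<le> n"
  shows "fund_seq w n < \<infinity>"
  using assms by (simp add: fund_seq_eq) (simp add: weight_seq_def)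

text \<open>
  Recovers the sequence from its rearrangement. A top set \<open>A\<close> of size \<open>n\<^sub>0\<close> carries the sum
  \<open>n\<^sub>0 c\<close>, while \<open>T\<^sub>1(x) = c\<close> bounds each entry, so every entry on \<open>A\<close> has modulus \<open>c\<close>; a nonzero
  entry outside \<open>A\<close> would push \<open>T\<close> at \<open>n\<^sub>0 + 1\<close> above \<open>n\<^sub>0 c\<close>.
\<close>

lemma flat_of_decr_rearr:
  fixes x :: "nat \<Rightarrow> real"
  assumes x: "x \<longlonglongrightarrow> 0" and c: "0 < c"
    and d: "\<And>n. 1 \<le> n \<Longrightarrow> decr_rearr x n = ennreal c * indicator {1..n0} n"
  obtains A where "finite A" "A \<subseteq> {1..}" "card A = n0"
    "\<And>k. k \<in> A \<Longrightarrow> \<bar>x k\<bar> = c" "\<And>k. 1 \<le> k \<Longrightarrow> k \<notin> A \<Longrightarrow> x k = 0"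
proof -
  obtain A where A: "top_set x A" "card A = n0" using ex_top_set[OF x] by auto
  then have fin: "finite A" "A \<subseteq> {1..}" by (auto simp: top_set_def)
  have T: "top_sum x n0 = ennreal (n0 * c)"
  proof -
    have "top_sum x n0 = (\<Sum>i=1..n0. ennreal c)"
      unfolding top_sum_def by (intro sum.cong) (auto simp: d)
    then show ?thesis using c by (simp add: ennreal_of_nat_eq_real_of_nat flip: ennreal_mult)
  qed
  have T': "top_sum x (Suc n0) = ennreal (n0 * c)"
    using T d[of "Suc n0"] by (simp add: top_sum_def)
  have s: "(\<Sum>i\<in>A. \<bar>x i\<bar>) = n0 * c"
    using T top_sum_eq[OF A] c by (simp add: sum_nonneg)
  have le: "\<bar>x k\<bar> \<le> c" if "k \<in> A" for k
  proof -
    have "n0 \<noteq> 0" using card_gt_0_iff[of A] that A(2) fin(1) by auto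
    then have "top_sum x 1 = ennreal c" using d[of 1] by (simp add: top_sum_def)
    then show ?thesis using sum_le_top_sum[of "{k}" 1 x] that fin(2) c by auto
  qed
  have "(\<Sum>i\<in>A. c - \<bar>x i\<bar>) = 0" using s A by (simp add: sum_subtractf)
  then have "\<forall>i\<in>A. c - \<bar>x i\<bar> = 0"
    using le fin by (subst (asm) sum_nonneg_eq_0_iff) auto
  moreover have "x k = 0" if "1 \<le> k" "k \<notin> A" for k
    using sum_le_top_sum[of "insert k A" "Suc n0" x] that fin A T' s c by simp
  ultimately show thesis using that[of A] fin A by auto
qed

section \<open>Extreme points have constant modulus on their support\<close>

lemma lorentz_sphereI:
  "y 0 = 0 \<Longrightarrow> lorentz_norm w y = 1 \<Longrightarrow> y \<in> lorentz_sphere w"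
  by (simp add: lorentz_sphere_def lorentz_space_def ell0_def)

text \<open>
  Truncation at height \<open>b = \<bar>x(j)\<bar>\<close> would split \<open>x\<close> into two comonotone parts of positive norm,
  and shifting weight between the two parts keeps the norm equal to 1.
\<close>

lemma extreme_point_abs_eq:
  assumes w: "weight_seq w" and x: "x \<longlonglongrightarrow> 0"
    and ext: "extreme_point_lorentz_ball w x"
    and ij: "1 \<le> i" "1 \<le> j" "x i \<noteq> 0" "x j \<noteq> 0"
  shows "\<bar>x i\<bar> \<le> \<bar>x j\<bar>"
proof (rule ccontr)
  assume less: "\<not> \<bar>x i\<bar> \<le> \<bar>x j\<bar>"
  have x1: "lorentz_norm w x = 1" and x0: "x 0 = 0"
    using ext by (auto simp: extreme_point_lorentz_ball_def lorentz_sphere_def lorentz_space_def ell0_def)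
  define b where "b = \<bar>x j\<bar>"
  have b: "0 < b" "b < \<bar>x i\<bar>" using less ij by (auto simp: b_def)
  define u where "u k = sgn (x k) * min \<bar>x k\<bar> b" for k
  define v where "v k = sgn (x k) * max (\<bar>x k\<bar> - b) 0" for k
  have u: "\<bar>u k\<bar> = min \<bar>x k\<bar> b" for k using b by (auto simp: u_def abs_mult abs_sgn_eq)
  have v: "\<bar>v k\<bar> = max (\<bar>x k\<bar> - b) 0" for k using b by (auto simp: v_def abs_mult abs_sgn_eq)
  have xuv: "x k = u k + v k" for k
    unfolding u_def v_def by (cases "x k" "0::real" rule: linorder_cases) auto
  have norm_comb: "lorentz_norm w (\<lambda>k. s * u k + t * v k)
      = ennreal s * lorentz_norm w u + ennreal t * lorentz_norm w v" if "0 \<le> s" "0 \<le> t" for s t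
  proof (rule lorentz_norm_comonotone[where f = "\<lambda>t. min t b" and g = "\<lambda>t. max (t - b) 0", OF w x _ u _ v that])
    show "mono (\<lambda>t. min t b)" "mono (\<lambda>t. max (t - b) 0)" by (auto intro!: monoI)
    show "\<bar>s * u k + t * v k\<bar> = s * \<bar>u k\<bar> + t * \<bar>v k\<bar>" for k
    proof -
      have "s * u k + t * v k = sgn (x k) * (s * \<bar>u k\<bar> + t * \<bar>v k\<bar>)"
        unfolding u v by (simp add: u_def v_def algebra_simps)
      moreover have "0 \<le> s * \<bar>u k\<bar> + t * \<bar>v k\<bar>" using that by simp
      moreover have "x k = 0 \<Longrightarrow> s * \<bar>u k\<bar> + t * \<bar>v k\<bar> = 0" by (simp add: u_def v_def)
      ultimately show ?thesis by (cases "x k = 0") (auto simp: abs_mult abs_sgn_eq)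
    qed
  qed
  have sum1: "lorentz_norm w u + lorentz_norm w v = 1"
    using norm_comb[of 1 1] x1 by (simp flip: xuv)
  obtain p q where pq: "lorentz_norm w u = ennreal p" "0 \<le> p" "lorentz_norm w v = ennreal q" "0 \<le> q"
    using sum1 by (cases "lorentz_norm w u"; cases "lorentz_norm w v") auto
  have pq1: "p + q = 1"
    using sum1 pq by (simp flip: ennreal_plus)
  have "u j \<noteq> 0" using u[of j] b by (auto simp: b_def)
  have "v j = 0" by (simp add: v_def b_def)
  have "v i \<noteq> 0" using v[of i] b by auto
  then have "0 < q" using lorentz_norm_pos[OF w ij(1), of v] pq by simp
  have p1: "p \<le> 1" "q \<le> 1" using pq1 pq by auto
  \<comment> \<open>The factors are chosen so that the gain \<open>q p\<close> on one part cancels the loss \<open>p q\<close> on the other;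
    since \<open>p, q \<le> 1\<close> they stay nonnegative, as additivity requires.\<close>
  define y where "y k = (1 + q) * u k + (1 - p) * v k" for k
  define z where "z k = (1 - q) * u k + (1 + p) * v k" for k
  have "lorentz_norm w y = ennreal ((1 + q) * p + (1 - p) * q)"
    unfolding y_def using norm_comb[of "1 + q" "1 - p"] pq p1 by (simp flip: ennreal_mult ennreal_plus)
  then have "y \<in> lorentz_sphere w"
    using pq1 by (intro lorentz_sphereI) (auto simp: y_def u_def v_def x0 algebra_simps)
  moreover have "lorentz_norm w z = ennreal ((1 - q) * p + (1 + p) * q)"
    unfolding z_def using norm_comb[of "1 - q" "1 + p"] pq p1 by (simp flip: ennreal_mult ennreal_plus)
  then have "z \<in> lorentz_sphere w"
    using pq1 by (intro lorentz_sphereI) (auto simp: z_def u_def v_def x0 algebra_simps)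
  moreover have "x = (\<lambda>k. (y k + z k) / 2)"
    by (simp add: fun_eq_iff y_def z_def xuv algebra_simps)
  ultimately have "y = z" using ext unfolding extreme_point_lorentz_ball_def by blast
  then have "y j = z j" by simp
  then have "q * u j = 0" using \<open>v j = 0\<close> by (simp add: y_def z_def algebra_simps)
  then show False using \<open>u j \<noteq> 0\<close> \<open>0 < q\<close> by simp
qed

text \<open>
  If the weight vanishes below \<open>n\<^sub>0\<close>, a sequence with at most \<open>n\<^sub>0\<close> nonzero entries enters the norm
  only through the sum of all its moduli.
\<close>

lemma lorentz_norm_eq_if_sum_eq:
  assumes w: "weight_seq w" and W: "W w (n0 - 1) = 0"
    and A: "finite A" "A \<subseteq> {1..}" "card A = n0"
    and x: "\<And>k. k \<notin> A \<Longrightarrow> x k = 0" and y: "\<And>k. k \<notin> A \<Longrightarrow> y k = 0"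
    and eq: "(\<Sum>k\<in>A. \<bar>x k\<bar>) = (\<Sum>k\<in>A. \<bar>y k\<bar>)"
  shows "lorentz_norm w x = lorentz_norm w y"
  unfolding lorentz_norm_top_sum[OF w]
proof (intro suminf_cong)
  fix n
  show "top_sum x (Suc n) * ennreal (w (Suc n) / real (Suc n))
      = top_sum y (Suc n) * ennreal (w (Suc n) / real (Suc n))"
  proof (cases "n0 \<le> Suc n")
    case True
    then show ?thesis
      using top_sum_supported[OF A(1,2) _ x] top_sum_supported[OF A(1,2) _ y] A(3) eq by simp
  next
    case False
    have "\<forall>i\<in>{1..n0 - 1}. w i = 0"
      using W w unfolding W_def weight_seq_def by (subst (asm) sum_nonneg_eq_0_iff) auto
    then show ?thesis using False by simp
  qed
qed

text \<open>
  Otherwise all the mass at one support point could be moved to another support point, in either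
  direction, without changing the norm; \<open>x\<close> is the midpoint of the two results.
\<close>

lemma extreme_point_W_pos:
  assumes w: "weight_seq w" and ext: "extreme_point_lorentz_ball w x"
    and A: "finite A" "A \<subseteq> {1..}" "1 < card A"
    and x: "\<And>k. k \<in> A \<Longrightarrow> \<bar>x k\<bar> = c" "\<And>k. k \<notin> A \<Longrightarrow> x k = 0" and c: "0 < c"
  shows "0 < W w (card A - 1)"
proof (rule ccontr)
  assume "\<not> 0 < W w (card A - 1)"
  moreover have "0 \<le> W w (card A - 1)"
    using w unfolding W_def weight_seq_def by (intro sum_nonneg) auto
  ultimately have W: "W w (card A - 1) = 0" by simp
  have x1: "lorentz_norm w x = 1"
    using ext by (auto simp: extreme_point_lorentz_ball_def lorentz_sphere_def)
  obtain i j where ij: "i \<in> A" "j \<in> A" "i \<noteq> j"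
    using A(3) card_le_Suc0_iff_eq[OF A(1)] by (auto simp: not_le[symmetric])
  \<comment> \<open>Doubling the entry at \<open>i\<close> compensates for deleting the entry at \<open>j\<close>, as both have modulus \<open>c\<close>.\<close>
  define move where "move i j = x(i := 2 * x i, j := 0)" for i j :: nat
  have "move i j \<in> lorentz_sphere w" if "i \<in> A" "j \<in> A" "i \<noteq> j" for i j
  proof (rule lorentz_sphereI)
    show "move i j 0 = 0" using that A(2) x(2)[of 0] by (auto simp: move_def)
    have "(\<Sum>k\<in>A. \<bar>move i j k\<bar>) = (\<Sum>k\<in>A. \<bar>x k\<bar>)"
    proof -
      have *: "(\<Sum>k\<in>A. h k) = h i + h j + (\<Sum>k\<in>A - {i, j}. h k)" for h :: "nat \<Rightarrow> real"
        using that A(1) sum.subset_diff[of "{i, j}" A h] by simp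
      have "(\<Sum>k\<in>A - {i, j}. \<bar>move i j k\<bar>) = (\<Sum>k\<in>A - {i, j}. \<bar>x k\<bar>)"
        by (intro sum.cong) (auto simp: move_def)
      then show ?thesis
        unfolding * using that x(1)[of i] x(1)[of j] by (simp add: move_def abs_mult)
    qed
    moreover have "move i j k = 0" if "k \<notin> A" for k
      using that \<open>i \<in> A\<close> \<open>j \<in> A\<close> x(2) by (auto simp: move_def)
    ultimately show "lorentz_norm w (move i j) = 1"
      using lorentz_norm_eq_if_sum_eq[OF w W A(1,2) refl, of "move i j" x] x(2) x1 by simp
  qed
  then have "move i j \<in> lorentz_sphere w" "move j i \<in> lorentz_sphere w" using ij by auto
  moreover have "x = (\<lambda>k. (move i j k + move j i k) / 2)"
    using ij by (auto simp: move_def)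
  ultimately have "move i j = move j i"
    using ext unfolding extreme_point_lorentz_ball_def by blast
  then have "move i j i = move j i i" by simp
  then show False using x(1)[OF ij(1)] c ij by (simp add: move_def)
qed

section \<open>Sequences of constant modulus on their support are extreme\<close>

text \<open>
  The nonnegative differences \<open>g n - f n\<close> have sum 0.
\<close>

lemma suminf_ennreal_eq_imp_eq:
  fixes f g :: "nat \<Rightarrow> ennreal"
  assumes le: "\<And>n. f n \<le> g n" and eq: "suminf g \<le> suminf f" and fin: "suminf f < \<infinity>"
  shows "f n = g n"
proof -
  define h where "h n = g n - f n" for n
  have g: "g n = f n + h n" for n
    unfolding h_def using diff_add_cancel_ennreal[OF le[of n]] by (metis add.commute)
  have "suminf g = suminf f + suminf h"
    unfolding g using suminf_add[of f h] by simp
  then have "suminf h = 0"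
    using eq fin ennreal_add_left_cancel_le[of "suminf f" "suminf h" 0] by auto
  then have "h n = 0" by (simp add: suminf_eq_zero_iff)
  then show ?thesis using g[of n] by simp
qed

text \<open>
  Convexity gives \<open>2 T\<^sub>n(x) \<le> T\<^sub>n(y) + T\<^sub>n(z)\<close> termwise, and the weighted sums of both sides agree,
  so at each \<open>n\<close> with \<open>w(n) > 0\<close> equality holds. The sets \<open>B\<close> and \<open>C\<close> are independent because
  \<open>T\<^sub>n(y)\<close> and \<open>T\<^sub>n(z)\<close> are maxima over all sets of size \<open>n\<close>.
\<close>

lemma midpoint_sums_le:
  assumes w: "weight_seq w"
    and norm: "lorentz_norm w x = 1" "lorentz_norm w y = 1" "lorentz_norm w z = 1"
    and x: "x \<longlonglongrightarrow> 0" and mid: "\<And>k. 2 * x k = y k + z k"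
    and n: "1 \<le> n" "0 < w n"
    and A: "top_set x A" "card A = n"
    and B: "finite B" "B \<subseteq> {1..}" "card B = n"
    and C: "finite C" "C \<subseteq> {1..}" "card C = n"
  shows "(\<Sum>k\<in>B. \<bar>y k\<bar>) + (\<Sum>k\<in>C. \<bar>z k\<bar>) \<le> 2 * (\<Sum>k\<in>A. \<bar>x k\<bar>)"
proof -
  define q where "q n = ennreal (w (Suc n) / real (Suc n))" for n
  have le: "2 * top_sum x n \<le> top_sum y n + top_sum z n" for n
  proof -
    obtain D where D: "top_set x D" "card D = n" using ex_top_set[OF x] by auto
    then have fin: "finite D" "D \<subseteq> {1..}" by (auto simp: top_set_def)
    have "2 * (\<Sum>k\<in>D. \<bar>x k\<bar>) \<le> (\<Sum>k\<in>D. \<bar>y k\<bar>) + (\<Sum>k\<in>D. \<bar>z k\<bar>)"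
      unfolding sum_distrib_left sum.distrib[symmetric]
    proof (rule sum_mono)
      show "2 * \<bar>x k\<bar> \<le> \<bar>y k\<bar> + \<bar>z k\<bar>" for k using mid[of k] by linarith
    qed
    then have "2 * top_sum x n \<le> ennreal (\<Sum>k\<in>D. \<bar>y k\<bar>) + ennreal (\<Sum>k\<in>D. \<bar>z k\<bar>)"
      unfolding top_sum_eq[OF D] using ennreal_leI[of "2 * (\<Sum>k\<in>D. \<bar>x k\<bar>)" "(\<Sum>k\<in>D. \<bar>y k\<bar>) + (\<Sum>k\<in>D. \<bar>z k\<bar>)"]
      by (simp add: ennreal_mult' sum_nonneg)
    also have "\<dots> \<le> top_sum y n + top_sum z n"
      using fin D by (intro add_mono sum_le_top_sum)
    finally show ?thesis .
  qed
  obtain m where m: "n = Suc m" using n by (cases n) auto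
  have sums: "(\<Sum>n. top_sum x (Suc n) * q n) = 1" "(\<Sum>n. top_sum y (Suc n) * q n) = 1"
      "(\<Sum>n. top_sum z (Suc n) * q n) = 1"
    using norm unfolding lorentz_norm_top_sum[OF w] q_def .
  have "2 * top_sum x (Suc m) * q m = (top_sum y (Suc m) + top_sum z (Suc m)) * q m"
  proof (rule suminf_ennreal_eq_imp_eq)
    show "2 * top_sum x (Suc n) * q n \<le> (top_sum y (Suc n) + top_sum z (Suc n)) * q n" for n
      by (intro mult_right_mono le) simp
    have s2: "(\<Sum>n. 2 * top_sum x (Suc n) * q n) = 2"
      unfolding mult.assoc ennreal_suminf_cmult sums by simp
    then show "(\<Sum>n. 2 * top_sum x (Suc n) * q n) < \<infinity>" by simp
    show "(\<Sum>n. (top_sum y (Suc n) + top_sum z (Suc n)) * q n) \<le> (\<Sum>n. 2 * top_sum x (Suc n) * q n)"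
      unfolding s2 distrib_right suminf_add[symmetric, OF summableI summableI] sums by simp
  qed
  moreover have "q m \<noteq> 0" "q m \<noteq> \<infinity>" using n m by (auto simp: q_def)
  ultimately have eq: "2 * top_sum x n = top_sum y n + top_sum z n"
    unfolding m by (auto simp: mult.commute[of _ "q m"] ennreal_mult_cancel_left)
  have "ennreal ((\<Sum>k\<in>B. \<bar>y k\<bar>) + (\<Sum>k\<in>C. \<bar>z k\<bar>)) \<le> top_sum y n + top_sum z n"
    using B C by (subst ennreal_plus) (auto intro!: sum_nonneg add_mono sum_le_top_sum)
  also have "\<dots> = ennreal (2 * (\<Sum>k\<in>A. \<bar>x k\<bar>))"
    using eq top_sum_eq[OF A] by (simp add: ennreal_mult')
  finally show ?thesis by (subst (asm) ennreal_le_iff) (auto intro!: sum_nonneg)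
qed

lemma W_inf_infinite_imp_frequently_pos:
  assumes "W_inf w = \<infinity>"
  shows "\<exists>n\<ge>N. 0 < w n"
proof (rule ccontr)
  assume "\<not> (\<exists>n\<ge>N. 0 < w n)"
  then have "ennreal (w (Suc i)) = 0" if "i \<notin> {..<N}" for i
  proof -
    have "N \<le> Suc i" using that by simp
    then have "w (Suc i) \<le> 0" using \<open>\<not> (\<exists>n\<ge>N. 0 < w n)\<close> not_less by blast
    then show ?thesis by (rule ennreal_neg)
  qed
  then have "W_inf w = (\<Sum>i<N. ennreal (w (Suc i)))"
    unfolding W_inf_def by (intro suminf_finite) auto
  then show False using assms ennreal_sum_less_top[of "{..<N}" "\<lambda>i. ennreal (w (Suc i))"] by (auto simp: less_top)
qed

text \<open>
  An index \<open>n > n\<^sub>0\<close> of positive weight forces \<open>y\<close> and \<open>z\<close> to have no cancellation and no mass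
  outside \<open>A\<close>; an index \<open>n < n\<^sub>0\<close> of positive weight forces \<open>\<bar>y\<bar>\<close> to be constant on \<open>A\<close>.
\<close>

lemma flat_extreme_point:
  assumes w: "weight_seq w" and inf: "W_inf w = \<infinity>" and xs: "x \<in> lorentz_sphere w"
    and A: "finite A" "A \<subseteq> {1..}" "1 \<le> card A"
    and xA: "\<And>k. k \<in> A \<Longrightarrow> \<bar>x k\<bar> = c" "\<And>k. k \<notin> A \<Longrightarrow> x k = 0" and c: "0 < c"
    and W: "1 < card A \<Longrightarrow> 0 < W w (card A - 1)"
  shows "extreme_point_lorentz_ball w x"
  unfolding extreme_point_lorentz_ball_def
proof (intro conjI ballI impI xs)
  fix y z assume ys: "y \<in> lorentz_sphere w" and zs: "z \<in> lorentz_sphere w"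
    and mid0: "x = (\<lambda>k. (y k + z k) / 2)"
  have x: "x \<longlonglongrightarrow> 0"
    using lorentz_space_tendsto_zero[OF w inf] xs by (auto simp: lorentz_sphere_def)
  have mid: "2 * x k = y k + z k" for k using fun_cong[OF mid0, of k] by simp
  have norm: "lorentz_norm w x = 1" "lorentz_norm w y = 1" "lorentz_norm w z = 1"
    using xs ys zs by (auto simp: lorentz_sphere_def)
  have zero: "x 0 = 0" "y 0 = 0" "z 0 = 0"
    using xs ys zs by (auto simp: lorentz_sphere_def lorentz_space_def ell0_def)
  note le = midpoint_sums_le[OF w norm x mid]
  have nonneg: "0 \<le> \<bar>y k\<bar> + \<bar>z k\<bar> - 2 * \<bar>x k\<bar>" for k using mid[of k] by linarith
  have abs_add: "\<bar>y k\<bar> + \<bar>z k\<bar> = 2 * \<bar>x k\<bar>" for k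
  proof (cases "k = 0")
    case False
    \<comment> \<open>One more than \<open>card A\<close> leaves room for an arbitrary index \<open>k\<close> next to all of \<open>A\<close>.\<close>
    obtain m where m: "Suc (card A) \<le> m" "0 < w m"
      using W_inf_infinite_imp_frequently_pos[OF inf] by blast
    have "card (insert k A) \<le> m" using m(1) card_insert_le_m1[of "Suc (card A)" A k] by simp
    then obtain B where B: "finite B" "insert k A \<subseteq> B" "B \<subseteq> {1..}" "card B = m"
      using ex_superset_card[of "insert k A" m] A False by auto
    have "top_set x B" using B xA(2) unfolding top_set_def by force
    then have "(\<Sum>k\<in>B. \<bar>y k\<bar> + \<bar>z k\<bar> - 2 * \<bar>x k\<bar>) \<le> 0"
      using le[of m B B B] m B by (simp add: sum_subtractf sum.distrib sum_distrib_left)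
    then have "(\<Sum>k\<in>B. \<bar>y k\<bar> + \<bar>z k\<bar> - 2 * \<bar>x k\<bar>) = 0"
      using nonneg by (intro antisym sum_nonneg)
    then have "\<forall>k\<in>B. \<bar>y k\<bar> + \<bar>z k\<bar> - 2 * \<bar>x k\<bar> = 0"
      using nonneg B(1) by (subst (asm) sum_nonneg_eq_0_iff) auto
    then show ?thesis using B(2) by auto
  qed (simp add: zero)
  have y_le: "\<bar>y i\<bar> \<le> \<bar>y j\<bar>" if ij: "i \<in> A" "j \<in> A" "i \<noteq> j" for i j
  proof -
    have c2: "2 \<le> card A" using card_mono[OF A(1), of "{i, j}"] ij by auto
    then have "0 < (\<Sum>i=1..card A - 1. w i)" using W by (simp add: W_def)
    then obtain m where m: "m \<in> {1..card A - 1}" "0 < w m"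
      using sum_nonpos[of "{1..card A - 1}" w] by (meson not_less)
    \<comment> \<open>Since \<open>m < card A\<close>, two sets of size \<open>m\<close> inside \<open>A\<close> can differ exactly in \<open>i\<close> and \<open>j\<close>: their
      common part \<open>D\<close> contributes equally to both sides of \<open>midpoint_sums_le\<close>.\<close>
    have "m - 1 \<le> card (A - {i, j})" using m(1) ij A(1) by (simp add: card_Diff_subset) linarith
    then obtain D where D: "D \<subseteq> A - {i, j}" "card D = m - 1" "finite D"
      by (meson obtain_subset_with_card_n)
    have cards: "card (insert i D) = m" "card (insert j D) = m"
      using D m(1) by (auto simp: card_insert_if subset_iff)
    have iD: "i \<notin> D" "j \<notin> D" using D(1) by auto
    have "insert i D \<subseteq> A" "insert j D \<subseteq> A" using D ij by auto
    have "top_set x (insert i D)"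
    proof -
      have "\<bar>x k\<bar> \<le> c" for k using xA[of k] c by (cases "k \<in> A") auto
      moreover have "\<bar>x k\<bar> = c" if "k \<in> insert i D" for k
        using that \<open>insert i D \<subseteq> A\<close> xA(1) by blast
      ultimately show ?thesis
        unfolding top_set_def using \<open>insert i D \<subseteq> A\<close> A(2) D(3) by (simp add: subset_iff)
    qed
    then have "(\<Sum>k\<in>insert i D. \<bar>y k\<bar>) + (\<Sum>k\<in>insert j D. \<bar>z k\<bar>) \<le> 2 * (\<Sum>k\<in>insert i D. \<bar>x k\<bar>)"
      using le[of m "insert i D" "insert i D" "insert j D"] m cards D A
        \<open>insert i D \<subseteq> A\<close> \<open>insert j D \<subseteq> A\<close> by auto
    moreover have "(\<Sum>k\<in>D. \<bar>y k\<bar>) + (\<Sum>k\<in>D. \<bar>z k\<bar>) = 2 * (\<Sum>k\<in>D. \<bar>x k\<bar>)"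
      by (simp add: abs_add sum_distrib_left flip: sum.distrib)
    ultimately have "\<bar>y i\<bar> + \<bar>z j\<bar> \<le> 2 * c"
      using D(3) iD xA(1)[OF ij(1)] by simp
    then show ?thesis using abs_add[of j] xA(1)[OF ij(2)] by linarith
  qed
  obtain a where a: "a \<in> A" using A(3) by fastforce
  have yA: "\<bar>y k\<bar> = \<bar>y a\<bar>" if "k \<in> A" for k
    using y_le[of k a] y_le[of a k] a that by (cases "k = a") auto
  have y0: "y k = 0" if "k \<notin> A" for k
    using abs_add[of k] xA(2)[OF that] by simp
  have "ennreal \<bar>y a\<bar> * fund_seq w (card A) = ennreal c * fund_seq w (card A)"
    using lorentz_norm_flat[OF A(1,2) yA y0] lorentz_norm_flat[OF A(1,2) xA] c norm by simp
  then have "\<bar>y a\<bar> = c"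
    using fund_seq_pos[OF w A(3)] fund_seq_finite[OF w A(3)] c
    by (auto simp: mult.commute[of _ "fund_seq w (card A)"] ennreal_mult_cancel_left)
  have "y k = x k \<and> z k = x k" for k
  proof -
    have "\<bar>y k\<bar> = \<bar>x k\<bar>"
      using yA[of k] y0[of k] xA[of k] \<open>\<bar>y a\<bar> = c\<close> by (cases "k \<in> A") auto
    then show ?thesis using abs_add[of k] mid[of k] by linarith
  qed
  then show "x = y" "y = z" by auto
qed

theorem theorem4p7:
  fixes w x :: "nat \<Rightarrow> real"
  assumes "weight_seq w"
    and "W_inf w = \<infinity>"
    and "x \<in> lorentz_sphere w"
  shows "extreme_point_lorentz_ball w x \<longleftrightarrow>
    (\<exists>n0\<ge>1. (\<forall>n\<ge>1. decr_rearr x n = 1 / fund_seq w n0 * indicator {1..n0} n) \<and>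
            (n0 > 1 \<longrightarrow> W w (n0 - 1) > 0))"
proof -
  note w = assms(1)
  have x: "x \<longlonglongrightarrow> 0"
    using lorentz_space_tendsto_zero[OF assms(1,2)] assms(3) by (auto simp: lorentz_sphere_def)
  have x1: "lorentz_norm w x = 1" and x0: "x 0 = 0"
    using assms(3) by (auto simp: lorentz_sphere_def lorentz_space_def ell0_def)
  show ?thesis
  proof
    assume ext: "extreme_point_lorentz_ball w x"
    define A where "A = {k. x k \<noteq> 0}"
    have sub: "A \<subseteq> {1..}" using x0 by (auto simp: A_def Suc_le_eq intro: gr0I)
    have "A \<noteq> {}"
    proof
      assume "A = {}"
      then have "lorentz_norm w x = 0"
        using lorentz_norm_flat[of "{}" x 0 w] by (auto simp: A_def)
      then show False using x1 by simp
    qed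
    then obtain a where a: "a \<in> A" by auto
    define c where "c = \<bar>x a\<bar>"
    have c: "0 < c" using a by (simp add: A_def c_def)
    have flat: "\<bar>x k\<bar> = c" if "k \<in> A" for k
      using extreme_point_abs_eq[OF w x ext, of k a] extreme_point_abs_eq[OF w x ext, of a k]
        a that sub by (auto simp: A_def c_def subset_iff)
    have off: "x k = 0" if "k \<notin> A" for k using that by (simp add: A_def)
    have fin: "finite A"
      using finite_level_set[OF x c] by (rule rev_finite_subset) (auto simp: flat)
    have n0: "1 \<le> card A" using fin \<open>A \<noteq> {}\<close> by (simp add: Suc_le_eq card_gt_0_iff)
    have "ennreal c * fund_seq w (card A) = 1"
      using lorentz_norm_flat[OF fin sub flat off] c x1 by simp
    then have "ennreal c = 1 / fund_seq w (card A)"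
      using fund_seq_pos[OF w n0] fund_seq_finite[OF w n0]
      using ennreal_mult_divide_eq[of "fund_seq w (card A)" "ennreal c"] by simp
    then show "\<exists>n0\<ge>1. (\<forall>n\<ge>1. decr_rearr x n = 1 / fund_seq w n0 * indicator {1..n0} n) \<and>
            (n0 > 1 \<longrightarrow> W w (n0 - 1) > 0)"
      using n0 decr_rearr_flat[OF fin sub flat off] c extreme_point_W_pos[OF w ext fin sub _ flat off c]
      by (intro exI[of _ "card A"]) auto
  next
    assume "\<exists>n0\<ge>1. (\<forall>n\<ge>1. decr_rearr x n = 1 / fund_seq w n0 * indicator {1..n0} n) \<and>
            (n0 > 1 \<longrightarrow> W w (n0 - 1) > 0)"
    then obtain n0 where n0: "1 \<le> n0"
      and d: "\<And>n. 1 \<le> n \<Longrightarrow> decr_rearr x n = 1 / fund_seq w n0 * indicator {1..n0} n"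
      and W: "n0 > 1 \<Longrightarrow> W w (n0 - 1) > 0" by auto
    obtain r where r: "fund_seq w n0 = ennreal r" "0 < r"
      using fund_seq_pos[OF w n0] fund_seq_finite[OF w n0]
      by (cases "fund_seq w n0") auto
    then have "1 / fund_seq w n0 = ennreal (1 / r)"
      using divide_ennreal[of 1 r] by simp
    then obtain A where A: "finite A" "A \<subseteq> {1..}" "card A = n0"
      and flat: "\<And>k. k \<in> A \<Longrightarrow> \<bar>x k\<bar> = 1 / r" and off: "\<And>k. 1 \<le> k \<Longrightarrow> k \<notin> A \<Longrightarrow> x k = 0"
      using flat_of_decr_rearr[OF x, of "1 / r" n0] d r by auto
    have "x k = 0" if "k \<notin> A" for k using off[of k] x0 that by (cases "k = 0") auto
    then show "extreme_point_lorentz_ball w x"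
      using flat_extreme_point[OF assms A(1,2) _ flat] A(3) n0 r W by auto
  qed
qed

end
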